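(* Let $E$ be an infinite-dimensional Banach space over $\mathbb{F}\in\{\mathbb{R},\mathbb{C}\}$. The following assertions are equivalent: (i) $E$ is Gelfand--Phillips. (ii) For every bounded non-precompact set $X\subseteq E$ there exists a continuous linear operator $T:E\to c_0$ such that $T(X)$ is not precompact in the Banach space $c_0$. (iii) For every bounded non-precompact set $X\subseteq E$ there is a weak$^\ast$ null sequence $(\chi_n)_{n\in\omega}$ in $E'$ such that $\|\chi_n\|_X\not\to 0$. (iv) For every bounded non-precompact set $B\subseteq E$ there exists an infinite subset $X\subseteq B$ such that the space $E'_{w^\ast}$ is selectively sequentially pseudocompact at some $(X-X)$-norming set $S\subseteq E'$.
   Context: $\mathbb{F}$ is the field of real or complex numbers, $\omega$ is the set of nonnegative integers, $E'$ is the dual Banach space of $E$, $E'_{w^\ast}$ is $E'$ with the weak$^\ast$ topology, and $c_0$ is the Banach space (over $\mathbb{F}$, with sup-norm) of null sequences. For a bounded set $B\subseteq E$ and $\chi\in E'$, put $\|\chi\|_B:=\sup\{|\chi(x)|:x\in B\}$. A subset of a Banach space is precompact if its closure in that space is compact. A bounded subset $B\subseteq E$ is limited if $\lim_n\|\chi_n\|_B=0$ for every weak$^\ast$ null sequence $(\chi_n)_{n\in\omega}$ in $E'$. The space $E$ is Gelfand--Phillips if every limited set in $E$ is precompact. A topological space $Y$ is selectively sequentially pseudocompact at a subset $A\subseteq Y$ if for any open sets $U_n\subseteq Y$, $n\in\omega$, each intersecting $A$, there exists a sequence $(x_n)_{n\in\omega}\in\prod_{n\in\omega}U_n$ containing a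 subsequence that converges in $Y$. For a subset $D\subseteq E$, a (norm-)bounded subset $S\subseteq E'$ is $D$-norming if there is a constant $\lambda>0$ such that $\tfrac1\lambda\|x\|_S\le\|x\|\le\lambda\|x\|_S$ for every $x\in D$, where $\|x\|_S:=\sup_{\chi\in S}|\chi(x)|$. Here $X-X=\{x-y:x,y\in X\}$. *)

theory Defs
  imports "HOL-Analysis.Analysis"
begin

section \<open>The scalar field\<close>

text \<open>A type of this class is, up to isometric isomorphism of normed fields, the field of
  real or the field of complex numbers.\<close>

class real_or_complex = real_normed_field +
  assumes isometric_to_real_or_complex:
    "\<exists>h :: 'a \<Rightarrow> complex. (\<forall>a b. h (a + b) = h a + h b) \<and> (\<forall>r a. h (scaleR r a) = scaleR r (h a)) \<and>
       (\<forall>a b. h (a * b) = h a * h b) \<and> h 1 = 1 \<and>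
       (\<forall>a. norm (h a) = norm a) \<and> (range h = \<real> \<or> range h = UNIV)"

instance real :: real_or_complex
  by standard
    (rule exI[of _ complex_of_real], auto simp: Reals_def scaleR_conv_of_real)

instance complex :: real_or_complex
  by standard (rule exI[of _ "\<lambda>z. z"], auto)


section \<open>Banach spaces, their duals and the space of null sequences\<close>

text \<open>The class \<open>banach\<close> only provides the underlying real structure; the scalar
  multiplication by the field \<open>'k\<close> extends it.\<close>

locale banach_space_over = vector_space scl
  for scl :: "'k::real_or_complex \<Rightarrow> 'a::banach \<Rightarrow> 'a" +
  assumes scale_of_real: "scl (of_real r) x = r *\<^sub>R x"
    and norm_scale: "norm (scl c x) = norm c * norm x"

definition infinite_dimensional :: "('k::field \<Rightarrow> 'a::ab_group_add \<Rightarrow> 'a) \<Rightarrow> bool" where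
  "infinite_dimensional scl \<longleftrightarrow> \<not> (\<exists>B. finite B \<and> module.span scl B = UNIV)"

text \<open>The norm of the dual space is the operator norm inherited from \<open>'a \<Rightarrow>\<^sub>L 'k\<close>, and its
  weak* topology is the topology of pointwise convergence.\<close>

definition dual :: "('k::real_normed_field \<Rightarrow> 'a::real_normed_vector \<Rightarrow> 'a) \<Rightarrow> ('a \<Rightarrow>\<^sub>L 'k) set" where
  "dual scl = {\<phi>. \<forall>c x. blinfun_apply \<phi> (scl c x) = c * blinfun_apply \<phi> x}"

definition weak_star :: "('k::real_normed_field \<Rightarrow> 'a::real_normed_vector \<Rightarrow> 'a) \<Rightarrow> ('a \<Rightarrow>\<^sub>L 'k) topology" where
  "weak_star scl = subtopology strong_operator_topology (dual scl)"

definition weak_star_null ::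
    "('k::real_normed_field \<Rightarrow> 'a::real_normed_vector \<Rightarrow> 'a) \<Rightarrow> (nat \<Rightarrow> 'a \<Rightarrow>\<^sub>L 'k) \<Rightarrow> bool" where
  "weak_star_null scl \<phi> \<longleftrightarrow>
     (\<forall>n. \<phi> n \<in> dual scl) \<and> limitin (weak_star scl) \<phi> 0 sequentially"

text \<open>All functions on the discrete space \<open>nat\<close> are continuous, so \<open>nat \<Rightarrow>\<^sub>C 'k\<close> is the space of
  bounded sequences with the supremum norm.\<close>

definition c0 :: "(nat \<Rightarrow>\<^sub>C 'k::real_normed_field) set" where
  "c0 = {f. apply_bcontfun f \<longlonglongrightarrow> 0}"

definition operator_to_c0 ::
    "('k::real_normed_field \<Rightarrow> 'a::real_normed_vector \<Rightarrow> 'a) \<Rightarrow> ('a \<Rightarrow> (nat \<Rightarrow>\<^sub>C 'k)) \<Rightarrow> bool" where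
  "operator_to_c0 scl T \<longleftrightarrow> bounded_linear T \<and> range T \<subseteq> c0 \<and>
     (\<forall>c x n. apply_bcontfun (T (scl c x)) n = c * apply_bcontfun (T x) n)"

definition precompact_in :: "'b topology \<Rightarrow> 'b set \<Rightarrow> bool" where
  "precompact_in Y A \<longleftrightarrow> compactin Y (Y closure_of A)"


section \<open>Limited sets, norming sets and selective sequential pseudocompactness\<close>

text \<open>Inserting \<open>0\<close> does not change the supremum of a nonempty set of norms, and makes the
  supremum over the empty set equal to \<open>0\<close>.\<close>

definition sup_on_points :: "'a::real_normed_vector set \<Rightarrow> ('a \<Rightarrow>\<^sub>L 'k::real_normed_vector) \<Rightarrow> real" where
  "sup_on_points B \<phi> = Sup (insert 0 ((\<lambda>x. norm (blinfun_apply \<phi> x)) ` B))"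

definition sup_on_functionals :: "('a::real_normed_vector \<Rightarrow>\<^sub>L 'k::real_normed_vector) set \<Rightarrow> 'a \<Rightarrow> real" where
  "sup_on_functionals S x = Sup (insert 0 ((\<lambda>\<phi>. norm (blinfun_apply \<phi> x)) ` S))"

definition limited :: "('k::real_normed_field \<Rightarrow> 'a::real_normed_vector \<Rightarrow> 'a) \<Rightarrow> 'a set \<Rightarrow> bool" where
  "limited scl B \<longleftrightarrow> bounded B \<and>
     (\<forall>\<phi>. weak_star_null scl \<phi> \<longrightarrow> (\<lambda>n. sup_on_points B (\<phi> n)) \<longlonglongrightarrow> 0)"

definition gelfand_phillips :: "('k::real_normed_field \<Rightarrow> 'a::real_normed_vector \<Rightarrow> 'a) \<Rightarrow> bool" where
  "gelfand_phillips scl \<longleftrightarrow> (\<forall>B. limited scl B \<longrightarrow> precompact_in euclidean B)"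

definition selectively_sequentially_pseudocompact_at :: "'b topology \<Rightarrow> 'b set \<Rightarrow> bool" where
  "selectively_sequentially_pseudocompact_at Y A \<longleftrightarrow> A \<subseteq> topspace Y \<and>
     (\<forall>U :: nat \<Rightarrow> 'b set. (\<forall>n. openin Y (U n) \<and> U n \<inter> A \<noteq> {}) \<longrightarrow>
        (\<exists>x. (\<forall>n. x n \<in> U n) \<and>
           (\<exists>r l. strict_mono r \<and> limitin Y (x \<circ> r) l sequentially)))"

definition norming ::
    "('k::real_normed_field \<Rightarrow> 'a::real_normed_vector \<Rightarrow> 'a) \<Rightarrow> 'a set \<Rightarrow> ('a \<Rightarrow>\<^sub>L 'k) set \<Rightarrow> bool" where
  "norming scl D S \<longleftrightarrow> S \<subseteq> dual scl \<and> bounded S \<and>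
     (\<exists>L>0. \<forall>x\<in>D. 1 / L * sup_on_functionals S x \<le> norm x \<and>
                  norm x \<le> L * sup_on_functionals S x)"

definition differences :: "'a::group_add set \<Rightarrow> 'a set" where
  "differences X = {x - y | x y. x \<in> X \<and> y \<in> X}"

end

theory Submission
  imports Defs "HOL-Library.Ramsey"
begin

text \<open>
  Call a bounded set detected if some weak* null sequence of functionals does not tend to zero
  uniformly on it; a bounded set is limited iff it is not detected. The Gelfand--Phillips property
  therefore says that every bounded non-precompact set is detected, which is the condition
  on functionals.

  Operators into \<open>c0\<close> and weak* null sequences are the same objects: \<open>T\<close> corresponds to
  its sequence of coordinates. Continuity of \<open>T\<close> is the uniform boundedness principle,
  and a bounded subset of \<open>c0\<close> is precompact iff its elements tend to zero uniformly
  (\<open>precompact_in_c0_iff\<close>). So \<open>T ` X\<close> is non-precompact iff the coordinates of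
  \<open>T\<close> detect \<open>X\<close>.

  Suppose that \<open>\<phi>\<close> detects \<open>B\<close>, say \<open>a \<le> norm (\<phi> n (b n))\<close> for infinitely
  many \<open>n\<close>. Since \<open>\<phi> m (b n)\<close> tends to zero with \<open>m\<close>, Ramsey's theorem thins the
  indices out so that \<open>norm (\<phi> m (b n)) < a / 2\<close> for \<open>n < m\<close>. Then
  \<open>\<phi> m\<close> separates \<open>b m\<close> from \<open>b n\<close> by at least \<open>a / 2\<close>, so the
  remaining functionals are norming for the differences of the remaining points
  (\<open>weak_star_null_imp_norming\<close>). Selective sequential pseudocompactness at a set of members of a
  weak* null sequence is clear, because any sequence of such members has a weak* convergent
  subsequence.

  Conversely, a non-precompact set contains an infinite \<open>r\<close>-separated sequence, and its
  range is again non-precompact. The last condition, applied to this range and not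
  to the given set, yields an infinite set \<open>X\<close> that is still \<open>r\<close>-separated, and a
  bounded set \<open>S\<close> of functionals whose members separate the points of \<open>X\<close> by
  some fixed \<open>d > 0\<close>. The points of \<open>X\<close>, as functions on \<open>S\<close>, form a bounded family
  that is not totally bounded, so, as in the Arzela--Ascoli theorem, it cannot be equicontinuous
  (\<open>separated_points_not_equicontinuous\<close>). This failure produces \<open>s n\<close> in
  \<open>S\<close> and \<open>x n\<close> in \<open>X\<close> such that \<open>s m\<close> and \<open>s n\<close> differ by at
  least a fixed \<open>c\<close> at \<open>x m\<close> whenever \<open>m < n\<close>
  (\<open>separated_points_diagonal_jump\<close>). This is an open condition that involves only finitely many
  points for each functional, so it survives, with a smaller constant, in suitable weak*
  neighbourhoods of the \<open>s n\<close>. Hence no sequence chosen from these neighbourhoods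
  has a subsequence that is uniformly Cauchy on \<open>X\<close>, whereas pseudocompactness provides a choice
  with a weak* convergent subsequence. The latter, minus its limit, detects \<open>X\<close>
  (\<open>norming_imp_weak_star_null\<close>).
\<close>

section \<open>Extraction of sequences and subsets\<close>

text \<open>Ramsey's theorem for pairs, for a relation instead of a colouring of two-element
  sets: the pair is recovered from the set as its minimum and maximum.\<close>

lemma Ramsey_pairs_nat:
  fixes N :: "nat set"
  assumes "infinite N"
  obtains Y where "Y \<subseteq> N" "infinite Y"
    "(\<forall>n\<in>Y. \<forall>m\<in>Y. n < m \<longrightarrow> P n m) \<or> (\<forall>n\<in>Y. \<forall>m\<in>Y. n < m \<longrightarrow> \<not> P n m)"
proof -
  define f where "f A = (if P (Min A) (Max A) then 0 else 1::nat)" for A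
  have "\<forall>x\<in>N. \<forall>y\<in>N. x \<noteq> y \<longrightarrow> f {x, y} < 2"
    by (simp add: f_def)
  from Ramsey2[OF assms this] obtain Y t where Y: "Y \<subseteq> N" "infinite Y"
    and t: "\<forall>x\<in>Y. \<forall>y\<in>Y. x \<noteq> y \<longrightarrow> f {x, y} = t"
    by (elim exE conjE)
  have mm: "Min {n, m} = n" "Max {n, m} = m" if "n < m" for n m :: nat
    using that by auto
  have "P n m \<longleftrightarrow> t = 0" if "n \<in> Y" "m \<in> Y" "n < m" for n m
    using t[rule_format, OF that(1,2)] that(3) mm[OF that(3)] by (auto simp: f_def split: if_splits)
  then show ?thesis
    using that[OF Y] by metis
qed

text \<open>A choice that is possible against any finite set of previous choices can be repeated
  forever.\<close>

lemma greedy_sequence: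
  assumes "\<And>F. finite F \<Longrightarrow> F \<subseteq> A \<Longrightarrow> \<exists>x\<in>A. \<forall>y\<in>F. P y x"
  shows "\<exists>f :: nat \<Rightarrow> 'a. (\<forall>n. f n \<in> A) \<and> (\<forall>m n. m < n \<longrightarrow> P (f m) (f n))"
proof -
  have "\<exists>f :: nat \<Rightarrow> 'a. \<forall>n. f n \<in> A \<and> (\<forall>m<n. P (f m) (f n))"
  proof (rule dependent_wellorder_choice)
    fix n :: nat and f :: "nat \<Rightarrow> 'a"
    assume "\<And>m. m < n \<Longrightarrow> f m \<in> A \<and> (\<forall>k<m. P (f k) (f m))"
    then have "f ` {..<n} \<subseteq> A" by blast
    from assms[OF _ this] show "\<exists>r. r \<in> A \<and> (\<forall>m<n. P (f m) r)"
      by auto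
  qed auto
  then show ?thesis
    by metis
qed

section \<open>Bounded sets of scalars\<close>

text \<open>The scalar field is only known up to isometry, so local compactness is carried over from
  the image of the field in the complex numbers, which is closed.\<close>

lemma compact_cball_real_or_complex:
  "compact (cball (0 :: 'k::real_or_complex) r)"
proof -
  obtain h :: "'k \<Rightarrow> complex" where add: "\<And>a b. h (a + b) = h a + h b"
    and scaleR: "\<And>c a. h (c *\<^sub>R a) = c *\<^sub>R h a"
    and norm: "\<And>a. norm (h a) = norm a" and range: "range h = \<real> \<or> range h = UNIV"
    using isometric_to_real_or_complex by blast
  have diff: "h (a - b) = h a - h b" for a b
    using add[of a "(-1) *\<^sub>R b"] scaleR[of "-1" b] by simp
  have dist: "dist (h a) (h b) = dist a b" for a b
    by (simp add: dist_norm norm flip: diff)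
  then have inj: "inj h"
    by (metis dist_eq_0_iff injI)
  have "closed (range h)"
    using range closed_complex_Reals by auto
  then have "compact (cball 0 r \<inter> range h)"
    by (intro compact_Int_closed compact_cball)
  moreover have "continuous_on (cball 0 r \<inter> range h) (inv h)"
    unfolding continuous_on_iff
  proof (intro ballI allI impI)
    fix x and \<epsilon> :: real
    assume "x \<in> cball 0 r \<inter> range h" "0 < \<epsilon>"
    then show "\<exists>\<delta>>0. \<forall>y\<in>cball 0 r \<inter> range h. dist y x < \<delta> \<longrightarrow> dist (inv h y) (inv h x) < \<epsilon>"
      using dist inj by (intro exI[of _ \<epsilon>]) auto
  qed
  ultimately have "compact (inv h ` (cball 0 r \<inter> range h))"
    by (metis compact_continuous_image)
  moreover have "cball 0 r \<inter> range h = h ` cball 0 r"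
    by (auto simp: norm)
  ultimately show ?thesis
    by (simp add: image_inv_f_f[OF inj])
qed

lemma bounded_finite_net:
  fixes A :: "'k::real_or_complex set"
  assumes "bounded A" "0 < r"
  obtains K where "finite K" "A \<subseteq> (\<Union>k\<in>K. ball k r)"
proof -
  obtain b where "A \<subseteq> cball 0 b"
    using assms(1) by (auto simp: bounded_iff subset_iff)
  moreover obtain K where "finite K" "cball (0::'k) b \<subseteq> (\<Union>k\<in>K. ball k r)"
    using compact_cball_real_or_complex[of b, where 'k = 'k] assms(2)
    by (auto simp: compact_eq_totally_bounded)
  ultimately show ?thesis using that by (meson order_trans)
qed

section \<open>Separated points and failure of equicontinuity\<close>

lemma infinite_subset_in_ball:
  assumes "infinite X" "finite K" "e ` X \<subseteq> (\<Union>k\<in>K. ball k (r/2))"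
  shows "\<exists>Y\<subseteq>X. infinite Y \<and> (\<forall>x\<in>Y. \<forall>y\<in>Y. dist (e x) (e y) < r)"
proof -
  have "\<exists>k\<in>K. dist k (e x) < r/2" if "x \<in> X" for x
    using subsetD[OF assms(3) imageI[OF that]] by auto
  then obtain k where k: "k \<in> K" "infinite {x \<in> X. dist k (e x) < r/2}"
    using pigeonhole_infinite_rel[OF assms(1,2), of "\<lambda>x k. dist k (e x) < r/2"] by auto
  have "dist (e x) (e y) < r" if "dist k (e x) < r/2" "dist k (e y) < r/2" for x y
    using that by (metis dist_commute dist_triangle_half_r)
  then show ?thesis
    using k by (intro exI[of _ "{x \<in> X. dist k (e x) < r/2}"]) auto
qed

text \<open>Pigeonhole, once for each of the finitely many functions.\<close>

lemma infinite_subset_almost_constant: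
  fixes e :: "'s \<Rightarrow> 'x \<Rightarrow> 'k::real_or_complex"
  assumes "finite I" "infinite X" "\<And>s. s \<in> I \<Longrightarrow> bounded (e s ` X)" "0 < r"
  shows "\<exists>Y\<subseteq>X. infinite Y \<and> (\<forall>s\<in>I. \<forall>x\<in>Y. \<forall>y\<in>Y. dist (e s x) (e s y) < r)"
  using assms(1,3)
proof (induction I)
  case empty
  then show ?case using assms(2) by auto
next
  case (insert s I)
  then obtain Y where Y: "Y \<subseteq> X" "infinite Y"
    and I: "\<forall>s\<in>I. \<forall>x\<in>Y. \<forall>y\<in>Y. dist (e s x) (e s y) < r"
    by (metis insertCI)
  have "bounded (e s ` Y)"
    using insert.prems Y(1) by (meson bounded_subset image_mono insertI1)
  then obtain K where "finite K" "e s ` Y \<subseteq> (\<Union>k\<in>K. ball k (r/2))"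
    using bounded_finite_net assms(4) half_gt_zero by metis
  then obtain Z where "Z \<subseteq> Y" "infinite Z"
    "\<forall>x\<in>Z. \<forall>y\<in>Z. dist (e s x) (e s y) < r"
    using infinite_subset_in_ball[OF Y(2), of K "e s" r] by auto
  with I Y(1) show ?case
    by (intro exI[of _ Z]) blast
qed

text \<open>If no finite subset of \<open>S\<close> worked, one could choose infinitely many elements of
  \<open>S\<close> that are pairwise \<open>r\<close>-distinguished on \<open>F\<close>. But each point of \<open>F\<close> is a
  bounded function of the element of \<open>S\<close>, so on infinitely many of the chosen elements all points of
  \<open>F\<close> are almost constant.\<close>

lemma finite_pointwise_net:
  fixes e :: "'s \<Rightarrow> 'x \<Rightarrow> 'k::real_or_complex"
  assumes "finite F" "\<And>x. x \<in> F \<Longrightarrow> bounded ((\<lambda>s. e s x) ` S)" "0 < r"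
  shows "\<exists>G\<subseteq>S. finite G \<and> (\<forall>s\<in>S. \<exists>t\<in>G. \<forall>x\<in>F. dist (e t x) (e s x) < r)"
proof (rule ccontr)
  assume no: "\<not> ?thesis"
  have "\<exists>s\<in>S. \<forall>t\<in>G. \<not> (\<forall>x\<in>F. dist (e t x) (e s x) < r)" if "finite G" "G \<subseteq> S" for G
    using no that by meson
  then obtain f :: "nat \<Rightarrow> 's" where f: "\<And>n. f n \<in> S"
    and far: "\<And>m n. m < n \<Longrightarrow> \<not> (\<forall>x\<in>F. dist (e (f m) x) (e (f n) x) < r)"
    using greedy_sequence[of S "\<lambda>t s. \<not> (\<forall>x\<in>F. dist (e t x) (e s x) < r)"] by metis
  have "bounded ((\<lambda>n. e (f n) x) ` UNIV)" if "x \<in> F" for x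
    by (rule bounded_subset[OF assms(2)[OF that]]) (use f in auto)
  then obtain Y :: "nat set" where Y: "infinite Y"
    and near: "\<forall>x\<in>F. \<forall>m\<in>Y. \<forall>n\<in>Y. dist (e (f m) x) (e (f n) x) < r"
    using infinite_subset_almost_constant[of F UNIV "\<lambda>x n. e (f n) x" r] assms(1,3) by auto
  obtain m where m: "m \<in> Y"
    using Y by (metis finite.emptyI ex_in_conv)
  then obtain n where "n \<in> Y" "m < n"
    using Y by (meson infinite_nat_iff_unbounded)
  with far near m show False
    by blast
qed

text \<open>The argument of the Arzela--Ascoli theorem. If closeness on some finite set \<open>F\<close> of
  points forced closeness at all points of \<open>X\<close>, then finitely many elements of \<open>S\<close>
  would determine the values of all of \<open>S\<close> on \<open>X\<close> up to \<open>d / 3\<close>. Two points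
  of \<open>X\<close> that these finitely many elements hardly tell apart would then be at distance less than
  \<open>d\<close> under every element of \<open>S\<close>.\<close>

lemma separated_points_not_equicontinuous:
  fixes e :: "'s \<Rightarrow> 'x \<Rightarrow> 'k::real_or_complex"
  assumes X: "infinite X" "\<And>s. s \<in> S \<Longrightarrow> bounded (e s ` X)"
    and S: "\<And>x. x \<in> X \<Longrightarrow> bounded ((\<lambda>s. e s x) ` S)"
    and d: "0 < d" "\<And>x y. x \<in> X \<Longrightarrow> y \<in> X \<Longrightarrow> x \<noteq> y \<Longrightarrow> \<exists>s\<in>S. d \<le> dist (e s x) (e s y)"
    and F: "finite F" "F \<subseteq> X" and r: "0 < r"
  shows "\<exists>s\<in>S. \<exists>t\<in>S. \<exists>x\<in>X. (\<forall>y\<in>F. dist (e s y) (e t y) < r) \<and> d / 3 \<le> dist (e s x) (e t x)"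
proof (rule ccontr)
  assume "\<not> ?thesis"
  then have equi: "dist (e s x) (e t x) < d / 3"
    if "s \<in> S" "t \<in> S" "x \<in> X" "\<forall>y\<in>F. dist (e s y) (e t y) < r" for s t x
    using that by (meson not_le)
  obtain G where G: "G \<subseteq> S" "finite G" "\<forall>s\<in>S. \<exists>t\<in>G. \<forall>y\<in>F. dist (e t y) (e s y) < r"
    using finite_pointwise_net[of F e S r] F S r by blast
  obtain Y where Y: "Y \<subseteq> X" "infinite Y"
    and const: "\<forall>t\<in>G. \<forall>x\<in>Y. \<forall>y\<in>Y. dist (e t x) (e t y) < d / 3"
    using infinite_subset_almost_constant[of G X e "d / 3"] G X d(1) by (auto simp: subset_iff)
  obtain x where x: "x \<in> Y"
    using Y(2) by (metis finite.emptyI ex_in_conv)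
  obtain y where y: "y \<in> Y" "x \<noteq> y"
    using Y(2) x by (metis finite.emptyI finite_insert insertI1 finite_subset subsetI)
  obtain s where s: "s \<in> S" "d \<le> dist (e s x) (e s y)"
    using d(2) x y Y(1) by blast
  obtain t where t: "t \<in> G" "\<forall>y\<in>F. dist (e t y) (e s y) < r"
    using G(3) s(1) by blast
  have "dist (e t x) (e s x) < d / 3" "dist (e t y) (e s y) < d / 3" "dist (e t x) (e t y) < d / 3"
    using equi[OF _ s(1) _ t(2)] t(1) G(1) x y(1) Y(1) const by auto
  moreover have "dist (e s x) (e s y) \<le> dist (e t x) (e s x) + dist (e t x) (e t y) + dist (e t y) (e s y)"
    by metric
  ultimately show False
    using s(2) by linarith
qed

text \<open>By the previous lemma one can choose successively \<open>s n\<close>, \<open>t n\<close> and \<open>x n\<close>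
  such that \<open>s n\<close> and \<open>t n\<close> are close at the earlier points and far apart at \<open>x n\<close>.
  Then \<open>s n\<close> cannot be close to \<open>s m\<close> at \<open>x m\<close> while \<open>t n\<close> is also
  close to \<open>t m\<close> there. By Ramsey's theorem one of the two sequences has the required property along a
  subsequence, and no limit of these sequences has to be formed.\<close>

lemma separated_points_diagonal_jump:
  fixes e :: "'s \<Rightarrow> 'x \<Rightarrow> 'k::real_or_complex"
  assumes X: "infinite X" "\<And>s. s \<in> S \<Longrightarrow> bounded (e s ` X)"
    and S: "\<And>x. x \<in> X \<Longrightarrow> bounded ((\<lambda>s. e s x) ` S)"
    and d: "0 < d" "\<And>x y. x \<in> X \<Longrightarrow> y \<in> X \<Longrightarrow> x \<noteq> y \<Longrightarrow> \<exists>s\<in>S. d \<le> dist (e s x) (e s y)"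
  shows "\<exists>c>0. \<exists>s x. (\<forall>n :: nat. s n \<in> S \<and> x n \<in> X) \<and>
    (\<forall>m n. m < n \<longrightarrow> c \<le> dist (e (s m) (x m)) (e (s n) (x m)))"
proof -
  \<comment> \<open>A third of the gap \<open>d / 3\<close> from the previous lemma, for a triangle inequality with three terms.\<close>
  define c where "c = d / 9"
  have c: "0 < c" using d(1) by (simp add: c_def)
  define A where "A = {(s, t, x). s \<in> S \<and> t \<in> S \<and> x \<in> X \<and> 3 * c \<le> dist (e s x) (e t x)}"
  define P where "P = (\<lambda>(_ :: 's, _ :: 's, x) (s, t, _ :: 'x). dist (e s x) (e t x) < c)"
  have "\<exists>p\<in>A. \<forall>q\<in>F. P q p" if "finite F" "F \<subseteq> A" for F
  proof -
    have "finite ((\<lambda>(_, _, x). x) ` F)" "(\<lambda>(_, _, x). x) ` F \<subseteq> X"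
      using that by (auto simp: A_def)
    from separated_points_not_equicontinuous[of X S e d, OF X S d this c]
    obtain s t x where "s \<in> S" "t \<in> S" "x \<in> X" "\<forall>y\<in>(\<lambda>(_, _, x). x) ` F. dist (e s y) (e t y) < c"
      "3 * c \<le> dist (e s x) (e t x)"
      by (auto simp: c_def)
    then show ?thesis
      by (intro bexI[of _ "(s, t, x)"]) (auto simp: A_def P_def)
  qed
  then obtain f :: "nat \<Rightarrow> _" where f: "\<And>n. f n \<in> A" "\<And>m n. m < n \<Longrightarrow> P (f m) (f n)"
    using greedy_sequence[of A P] by metis
  define s where "s n = fst (f n)" for n
  define t where "t n = fst (snd (f n))" for n
  define x where "x n = snd (snd (f n))" for n
  have fn: "f n = (s n, t n, x n)" for n
    by (simp add: s_def t_def x_def)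
  have mem: "s n \<in> S" "t n \<in> S" "x n \<in> X" and big: "3 * c \<le> dist (e (s n) (x n)) (e (t n) (x n))" for n
    using f(1)[of n] by (auto simp: A_def fn)
  have small: "dist (e (s n) (x m)) (e (t n) (x m)) < c" if "m < n" for m n
    using f(2)[OF that] by (simp add: P_def fn)
  obtain Y where Y: "infinite Y"
    "(\<forall>m\<in>Y. \<forall>n\<in>Y. m < n \<longrightarrow> c \<le> dist (e (s m) (x m)) (e (s n) (x m))) \<or>
     (\<forall>m\<in>Y. \<forall>n\<in>Y. m < n \<longrightarrow> \<not> c \<le> dist (e (s m) (x m)) (e (s n) (x m)))"
    by (rule Ramsey_pairs_nat[OF infinite_UNIV_nat, of "\<lambda>m n. c \<le> dist (e (s m) (x m)) (e (s n) (x m))"])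
  have "\<exists>u. (\<forall>n. u n \<in> S) \<and> (\<forall>m\<in>Y. \<forall>n\<in>Y. m < n \<longrightarrow> c \<le> dist (e (u m) (x m)) (e (u n) (x m)))"
    using Y(2)
  proof
    assume close: "\<forall>m\<in>Y. \<forall>n\<in>Y. m < n \<longrightarrow> \<not> c \<le> dist (e (s m) (x m)) (e (s n) (x m))"
    have "c \<le> dist (e (t m) (x m)) (e (t n) (x m))" if "m \<in> Y" "n \<in> Y" "m < n" for m n
    proof -
      have "dist (e (s m) (x m)) (e (t m) (x m)) \<le> dist (e (s m) (x m)) (e (s n) (x m))
          + dist (e (s n) (x m)) (e (t n) (x m)) + dist (e (t m) (x m)) (e (t n) (x m))"
        by metric
      then show ?thesis
        using close that big[of m] small[OF that(3)] by fastforce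
    qed
    then show ?thesis
      using mem(2) by blast
  qed (use mem(1) in blast)
  then obtain u where u: "\<And>n. u n \<in> S"
    "\<And>m n. m \<in> Y \<Longrightarrow> n \<in> Y \<Longrightarrow> m < n \<Longrightarrow> c \<le> dist (e (u m) (x m)) (e (u n) (x m))"
    by blast
  show ?thesis
    by (intro exI[of _ c] conjI exI[of _ "u \<circ> enumerate Y"] exI[of _ "x \<circ> enumerate Y"])
      (use c u mem(3) Y(1) in \<open>auto simp: enumerate_in_set\<close>)
qed

section \<open>Weak* null sequences\<close>

text \<open>The usual Baire category argument: the closed sets \<open>C m\<close> of points where all members
  of \<open>S\<close> are bounded by \<open>m\<close> cover the space, so one of them contains a ball, and
  linearity carries the bound to a ball around the origin.\<close>

lemma uniform_boundedness_principle:
  fixes S :: "('a::banach \<Rightarrow>\<^sub>L 'b::real_normed_vector) set"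
  assumes ptw: "\<And>x. bounded ((\<lambda>f. blinfun_apply f x) ` S)"
  shows "bounded S"
proof -
  define C where "C m = {x. \<forall>f\<in>S. norm (blinfun_apply f x) \<le> real m}" for m :: nat
  have closed: "closed (C m)" for m
  proof -
    have "C m = (\<Inter>f\<in>S. {x. norm (blinfun_apply f x) \<le> real m})"
      by (auto simp: C_def)
    then show ?thesis
      by (auto intro!: closed_INT closed_Collect_le continuous_intros)
  qed
  have cover: "(\<Union>m. C m) = UNIV"
  proof -
    have "\<exists>m. x \<in> C m" for x
    proof -
      obtain b where b: "\<forall>f\<in>S. norm (blinfun_apply f x) \<le> b"
        using ptw[of x] by (auto simp: bounded_iff)
      obtain m :: nat where "b \<le> real m"
        using real_arch_simple by blast
      with b show ?thesis
        unfolding C_def by (intro exI[of _ m]) force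
    qed
    then show ?thesis by blast
  qed
  have "\<exists>m. interior (C m) \<noteq> {}"
  proof (rule ccontr)
    assume "\<nexists>m. interior (C m) \<noteq> {}"
    then have empty: "closedin euclidean T \<and> euclidean interior_of T = {}" if "T \<in> range C" for T
      using that closed by auto
    have "euclidean interior_of \<Union>(range C) = {}"
      by (rule Baire_category_alt) (use empty completely_metrizable_space_euclidean in auto)
    then show False
      using cover by simp
  qed
  then obtain m x where "x \<in> interior (C m)"
    by blast
  then obtain r where r: "0 < r" "ball x r \<subseteq> C m"
    by (meson mem_interior)
  have "norm f \<le> 4 * real m / r" if f: "f \<in> S" for f
  proof (rule norm_blinfun_bound)
    fix y
    show "norm (blinfun_apply f y) \<le> 4 * real m / r * norm y"
    proof (cases "y = 0")
      case False
      define t where "t = r / (2 * norm y)"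
      have t: "0 < t" using r(1) False by (simp add: t_def)
      have "norm (t *\<^sub>R y) < r" using r(1) False by (simp add: t_def)
      then have "x + t *\<^sub>R y \<in> C m" "x \<in> C m"
        using r by (auto simp: subset_iff dist_norm)
      then have "norm (blinfun_apply f (x + t *\<^sub>R y)) \<le> m" "norm (blinfun_apply f x) \<le> m"
        using f by (auto simp: C_def)
      moreover have "t *\<^sub>R blinfun_apply f y = blinfun_apply f (x + t *\<^sub>R y) - blinfun_apply f x"
        by (simp add: blinfun.add_right blinfun.scaleR_right)
      ultimately have "norm (t *\<^sub>R blinfun_apply f y) \<le> 2 * real m"
        using norm_triangle_ineq4[of "blinfun_apply f (x + t *\<^sub>R y)" "blinfun_apply f x"] by simp
      then have "t * norm (blinfun_apply f y) \<le> 2 * real m"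
        using t by simp
      then show ?thesis
        using r(1) False by (simp add: t_def field_simps)
    qed (simp add: blinfun.zero_right)
  qed (use r in auto)
  then show ?thesis
    by (auto simp: bounded_iff)
qed

text \<open>The weak* topology is pulled back from a product topology, so convergence in it is
  pointwise convergence.\<close>

lemma limitin_weak_star:
  "limitin (weak_star scl) \<phi> l F \<longleftrightarrow>
     l \<in> dual scl \<and> eventually (\<lambda>n. \<phi> n \<in> dual scl) F \<and>
     (\<forall>x. ((\<lambda>n. blinfun_apply (\<phi> n) x) \<longlongrightarrow> blinfun_apply l x) F)"
proof -
  have "limitin strong_operator_topology \<phi> l F \<longleftrightarrow>
      (\<forall>x. ((\<lambda>n. blinfun_apply (\<phi> n) x) \<longlongrightarrow> blinfun_apply l x) F)" (is "?L \<longleftrightarrow> ?R")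
  proof
    assume ?L
    from continuous_map_limit[OF strong_operator_topology_continuous_evaluation this]
    show ?R by (simp add: o_def)
  next
    assume R: ?R
    then have lim: "limitin euclidean (\<lambda>n. blinfun_apply (\<phi> n)) (blinfun_apply l) F"
      unfolding euclidean_product_topology[symmetric] by (simp add: limitin_componentwise)
    show ?L
      unfolding limitin_def strong_operator_topology_topspace
    proof (intro conjI allI impI UNIV_I)
      fix U assume "openin strong_operator_topology U \<and> l \<in> U"
      then obtain W where "open W" "U = blinfun_apply -` W" "blinfun_apply l \<in> W"
        by (auto simp: strong_operator_topology_def openin_pullback_topology)
      then show "\<forall>\<^sub>F n in F. \<phi> n \<in> U"
        using lim by (auto simp: tendsto_def)
    qed
  qed
  then show ?thesis
    by (simp add: weak_star_def limitin_subtopology)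
qed

lemma topspace_weak_star: "topspace (weak_star scl) = dual scl"
  by (simp add: weak_star_def strong_operator_topology_topspace)

lemma openin_weak_star_ball:
  fixes s :: "'a::real_normed_vector \<Rightarrow>\<^sub>L 'k::real_normed_field"
  assumes "finite F"
  shows "openin (weak_star scl) {f \<in> dual scl. \<forall>x\<in>F. dist (blinfun_apply s x) (blinfun_apply f x) < r}"
proof -
  have "openin strong_operator_topology {f. \<forall>x\<in>F. blinfun_apply f x \<in> ball (blinfun_apply s x) r}"
    by (rule strong_operator_topology_basis[OF assms]) simp
  then show ?thesis
    unfolding weak_star_def openin_subtopology
    by (intro exI[of _ "{f. \<forall>x\<in>F. blinfun_apply f x \<in> ball (blinfun_apply s x) r}"]) auto
qed

lemma zero_in_dual: "0 \<in> dual scl"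
  by (simp add: dual_def)

lemma diff_in_dual: "f \<in> dual scl \<Longrightarrow> g \<in> dual scl \<Longrightarrow> f - g \<in> dual scl"
  by (simp add: dual_def blinfun.diff_left right_diff_distrib)

lemma weak_star_null_iff:
  "weak_star_null scl \<phi> \<longleftrightarrow>
     (\<forall>n. \<phi> n \<in> dual scl) \<and> (\<forall>x. (\<lambda>n. blinfun_apply (\<phi> n) x) \<longlonglongrightarrow> 0)"
  by (auto simp: weak_star_null_def limitin_weak_star zero_in_dual)

lemma weak_star_null_imp_bounded:
  fixes \<phi> :: "nat \<Rightarrow> 'a::banach \<Rightarrow>\<^sub>L 'k::real_normed_field"
  assumes "weak_star_null scl \<phi>"
  shows "bounded (range \<phi>)"
proof (rule uniform_boundedness_principle)
  fix x
  have "convergent (\<lambda>n. blinfun_apply (\<phi> n) x)"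
    using assms by (auto simp: weak_star_null_iff convergent_def)
  then have "bounded (range (\<lambda>n. blinfun_apply (\<phi> n) x))"
    using convergent_imp_Bseq Bseq_eq_bounded by blast
  then show "bounded ((\<lambda>f. blinfun_apply f x) ` range \<phi>)"
    by (simp add: image_image)
qed

text \<open>From here on, convergence of the suprema is treated as uniform convergence.\<close>

lemma sup_on_points_tendsto_0_iff:
  fixes \<phi> :: "nat \<Rightarrow> 'a::real_normed_vector \<Rightarrow>\<^sub>L 'k::real_normed_vector"
  assumes "bounded X"
  shows "(\<lambda>n. sup_on_points X (\<phi> n)) \<longlonglongrightarrow> 0 \<longleftrightarrow>
    uniform_limit X (\<lambda>n. blinfun_apply (\<phi> n)) (\<lambda>_. 0) sequentially"
proof -
  have bdd: "bdd_above (insert 0 ((\<lambda>x. norm (blinfun_apply f x)) ` X))" for f :: "'a \<Rightarrow>\<^sub>L 'k"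
    using bounded_linear_image[OF assms blinfun.bounded_linear_right[of f]]
    by (auto simp: bounded_iff intro: bdd_aboveI2)
  have ge: "norm (blinfun_apply f x) \<le> sup_on_points X f" if "x \<in> X" for f :: "'a \<Rightarrow>\<^sub>L 'k" and x
    unfolding sup_on_points_def by (rule cSup_upper) (use that bdd in auto)
  have ge0: "0 \<le> sup_on_points X f" for f :: "'a \<Rightarrow>\<^sub>L 'k"
    unfolding sup_on_points_def by (rule cSup_upper) (use bdd in auto)
  have le: "sup_on_points X f \<le> b" if "0 \<le> b" "\<And>x. x \<in> X \<Longrightarrow> norm (blinfun_apply f x) \<le> b"
    for f :: "'a \<Rightarrow>\<^sub>L 'k" and b
    unfolding sup_on_points_def by (rule cSup_least) (use that in auto)
  show ?thesis
  proof
    assume L: "(\<lambda>n. sup_on_points X (\<phi> n)) \<longlonglongrightarrow> 0"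
    show "uniform_limit X (\<lambda>n. blinfun_apply (\<phi> n)) (\<lambda>_. 0) sequentially"
    proof (rule uniform_limitI)
      fix r :: real assume "0 < r"
      with L have "\<forall>\<^sub>F n in sequentially. sup_on_points X (\<phi> n) < r"
        by (rule order_tendstoD)
      then show "\<forall>\<^sub>F n in sequentially. \<forall>x\<in>X. dist (blinfun_apply (\<phi> n) x) 0 < r"
        by eventually_elim (use ge le_less_trans in fastforce)
    qed
  next
    assume R: "uniform_limit X (\<lambda>n. blinfun_apply (\<phi> n)) (\<lambda>_. 0) sequentially"
    show "(\<lambda>n. sup_on_points X (\<phi> n)) \<longlonglongrightarrow> 0"
    proof (rule tendstoI)
      fix r :: real assume "0 < r"
      with uniform_limitD[OF R, of "r / 2"]
      have "\<forall>\<^sub>F n in sequentially. \<forall>x\<in>X. norm (blinfun_apply (\<phi> n) x) < r / 2"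
        by simp
      then show "\<forall>\<^sub>F n in sequentially. dist (sup_on_points X (\<phi> n)) 0 < r"
      proof eventually_elim
        case (elim n)
        then have "sup_on_points X (\<phi> n) \<le> r / 2"
          using \<open>0 < r\<close> by (intro le) (auto intro: less_imp_le)
        then show ?case
          using ge0[of "\<phi> n"] \<open>0 < r\<close> by simp
      qed
    qed
  qed
qed

lemma
  fixes S :: "('a::real_normed_vector \<Rightarrow>\<^sub>L 'k::real_normed_vector) set"
  assumes "bounded S"
  shows sup_on_functionals_upper: "f \<in> S \<Longrightarrow> norm (blinfun_apply f x) \<le> sup_on_functionals S x"
    and sup_on_functionals_nonneg: "0 \<le> sup_on_functionals S x"
proof -
  have "bounded ((\<lambda>f. blinfun_apply f x) ` S)"
    by (rule bounded_linear_image[OF assms blinfun.bounded_linear_left])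
  then have "bdd_above (insert 0 ((\<lambda>f. norm (blinfun_apply f x)) ` S))"
    by (auto simp: bounded_iff intro: bdd_aboveI2)
  then show "f \<in> S \<Longrightarrow> norm (blinfun_apply f x) \<le> sup_on_functionals S x"
    and "0 \<le> sup_on_functionals S x"
    unfolding sup_on_functionals_def by (auto intro!: cSup_upper)
qed

lemma sup_on_functionals_least:
  assumes "0 \<le> b" "\<And>f. f \<in> S \<Longrightarrow> norm (blinfun_apply f x) \<le> b"
  shows "sup_on_functionals S x \<le> b"
  unfolding sup_on_functionals_def by (rule cSup_least) (use assms in auto)

section \<open>Precompact sets and operators in the space of null sequences\<close>

text \<open>The box is the image of a product of compact discs, which is compact by Tychonoff's theorem.
  Within the box pointwise convergence is uniform convergence, because the
  tails are uniformly small.\<close>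

lemma compact_c0_box:
  fixes M :: "nat \<Rightarrow> real"
  assumes M: "M \<longlonglongrightarrow> 0"
  shows "compact {f :: nat \<Rightarrow>\<^sub>C 'k::real_or_complex. \<forall>n. norm (apply_bcontfun f n) \<le> M n}"
proof -
  define K :: "(nat \<Rightarrow> 'k) set" where "K = Pi\<^sub>E UNIV (\<lambda>n. cball 0 (M n))"
  have K: "g \<in> K \<longleftrightarrow> (\<forall>n. norm (g n) \<le> M n)" for g
    by (auto simp: K_def PiE_def)
  have "compactin (product_topology (\<lambda>_. euclidean) UNIV) K"
    unfolding K_def compactin_PiE by (simp add: compact_cball_real_or_complex)
  then have "compact K"
    by (simp add: euclidean_product_topology)
  have bcontfun: "g \<in> bcontfun" if "g \<in> K" for g
  proof -
    obtain b where "\<And>n. norm (M n) \<le> b"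
      using M convergent_imp_Bseq[of M] by (auto simp: convergent_def Bseq_def)
    then have "norm (g n) \<le> b" for n
      using that by (metis K abs_le_iff order_trans real_norm_def)
    then show ?thesis
      by (intro bcontfun_normI) auto
  qed
  have "continuous_on K Bcontfun"
    unfolding continuous_on_sequentially
  proof (intro allI ballI impI)
    fix u :: "nat \<Rightarrow> nat \<Rightarrow> 'k" and g
    assume g: "g \<in> K" and u: "(\<forall>j. u j \<in> K) \<and> u \<longlonglongrightarrow> g"
    show "(Bcontfun \<circ> u) \<longlonglongrightarrow> Bcontfun g"
    proof (rule uniform_limit_tendsto_bcontfun, rule uniform_limitI)
      fix r :: real assume r: "0 < r"
      obtain N where N: "\<And>n. N \<le> n \<Longrightarrow> M n < r / 2"
        using order_tendstoD(2)[OF M, of "r / 2"] r by (auto simp: eventually_sequentially)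
      have tail: "dist (u j n) (g n) < r" if "N \<le> n" for j n
      proof -
        have "norm (u j n) < r / 2" "norm (g n) < r / 2"
          using N[OF that] u g K by (metis le_less_trans)+
        then show ?thesis
          using norm_triangle_ineq4[of "u j n" "g n"] by (simp add: dist_norm)
      qed
      have "(\<lambda>j. u j n) \<longlonglongrightarrow> g n" for n
        by (rule continuous_on_tendsto_compose[OF continuous_on_product_coordinates[of n]]) (use u in auto)
      then have "\<forall>\<^sub>F j in sequentially. dist (u j n) (g n) < r" for n
        using r tendstoD by blast
      then have "\<forall>\<^sub>F j in sequentially. \<forall>n\<in>{..<N}. dist (u j n) (g n) < r"
        by (intro eventually_ball_finite) auto
      then show "\<forall>\<^sub>F j in sequentially. \<forall>n\<in>UNIV.
          dist (apply_bcontfun ((Bcontfun \<circ> u) j) n) (apply_bcontfun (Bcontfun g) n) < r"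
        by eventually_elim (use tail u g bcontfun in \<open>auto simp: Bcontfun_inverse not_less[symmetric]\<close>)
    qed
  qed
  then have "compact (Bcontfun ` K)"
    using \<open>compact K\<close> compact_continuous_image by blast
  moreover have "Bcontfun ` K = {f. \<forall>n. norm (apply_bcontfun f n) \<le> M n}"
  proof safe
    fix f :: "nat \<Rightarrow>\<^sub>C 'k" assume "\<forall>n. norm (apply_bcontfun f n) \<le> M n"
    then have "apply_bcontfun f \<in> K" by (simp add: K)
    then show "f \<in> Bcontfun ` K"
      by (metis apply_bcontfun_inverse imageI)
  next
    fix g n assume "g \<in> K"
    then show "norm (apply_bcontfun (Bcontfun g) n) \<le> M n"
      by (simp add: Bcontfun_inverse bcontfun K)
  qed
  ultimately show ?thesis by simp
qed

text \<open>A compact subset of \<open>c0\<close> is approximated by finitely many null sequences, which have a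
  common rate of decay up to any given error. Conversely, a bounded set that decays uniformly lies
  in a box whose sides are the suprema of the coordinates.\<close>

lemma precompact_in_c0_iff:
  fixes A :: "(nat \<Rightarrow>\<^sub>C 'k::real_or_complex) set"
  assumes A: "A \<subseteq> c0" "bounded A"
  shows "precompact_in (top_of_set c0) A \<longleftrightarrow>
    uniform_limit A (\<lambda>n f. apply_bcontfun f n) (\<lambda>_. 0) sequentially"
proof
  assume "precompact_in (top_of_set c0) A"
  then have C: "compact (top_of_set c0 closure_of A)" "top_of_set c0 closure_of A \<subseteq> c0"
    by (auto simp: precompact_in_def compactin_subtopology)
  have sub: "A \<subseteq> top_of_set c0 closure_of A"
    using A(1) by (simp add: closure_of_subset)
  show "uniform_limit A (\<lambda>n f. apply_bcontfun f n) (\<lambda>_. 0) sequentially"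
  proof (rule uniform_limitI)
    fix r :: real assume r: "0 < r"
    have cover: "top_of_set c0 closure_of A \<subseteq> (\<Union>g\<in>top_of_set c0 closure_of A. ball g (r / 2))"
      using r centre_in_ball half_gt_zero by blast
    obtain G where G: "G \<subseteq> top_of_set c0 closure_of A" "finite G"
      "top_of_set c0 closure_of A \<subseteq> (\<Union>g\<in>G. ball g (r / 2))"
      by (rule compactE_image[OF C(1) _ cover]) auto
    have "\<forall>\<^sub>F n in sequentially. \<forall>g\<in>G. dist (apply_bcontfun g n) 0 < r / 2"
      using G(2)
    proof (rule eventually_ball_finite, intro ballI)
      fix g assume "g \<in> G"
      then have "apply_bcontfun g \<longlonglongrightarrow> 0"
        using G(1) C(2) by (auto simp: c0_def)
      then show "\<forall>\<^sub>F n in sequentially. dist (apply_bcontfun g n) 0 < r / 2"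
        by (rule tendstoD) (use r in simp)
    qed
    then show "\<forall>\<^sub>F n in sequentially. \<forall>f\<in>A. dist (apply_bcontfun f n) 0 < r"
    proof eventually_elim
      case (elim n)
      show ?case
      proof
        fix f assume "f \<in> A"
        then obtain g where g: "g \<in> G" "dist g f < r / 2"
          using G(3) sub by fastforce
        then have "dist (apply_bcontfun g n) (apply_bcontfun f n) < r / 2"
          by (metis dist_fun_lt_imp_dist_val_lt)
        with elim g(1) show "dist (apply_bcontfun f n) 0 < r"
          by (meson dist_commute dist_triangle_half_r)
      qed
    qed
  qed
next
  assume unif: "uniform_limit A (\<lambda>n f. apply_bcontfun f n) (\<lambda>_. 0) sequentially"
  \<comment> \<open>The element \<open>0\<close> keeps the supremum meaningful when \<open>A\<close> is empty.\<close>
  define M where "M n = Sup (insert 0 ((\<lambda>f. norm (apply_bcontfun f n)) ` A))" for n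
  obtain b where b: "\<And>f. f \<in> A \<Longrightarrow> norm f \<le> b"
    using A(2) by (auto simp: bounded_iff)
  have bdd: "bdd_above (insert 0 ((\<lambda>f. norm (apply_bcontfun f n)) ` A))" for n
    by (auto intro!: bdd_aboveI2[of _ _ b] intro: order_trans[OF norm_bounded b])
  have M: "norm (apply_bcontfun f n) \<le> M n" if "f \<in> A" for f n
    unfolding M_def by (rule cSup_upper; use that bdd in auto)
  have M0: "0 \<le> M n" for n
    unfolding M_def by (rule cSup_upper; use bdd in auto)
  have lim: "M \<longlonglongrightarrow> 0"
  proof (rule tendstoI)
    fix r :: real assume "0 < r"
    with uniform_limitD[OF unif, of "r / 2"]
    have "\<forall>\<^sub>F n in sequentially. \<forall>f\<in>A. norm (apply_bcontfun f n) < r / 2"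
      by simp
    then show "\<forall>\<^sub>F n in sequentially. dist (M n) 0 < r"
    proof eventually_elim
      case (elim n)
      then have "M n \<le> r / 2"
        unfolding M_def using \<open>0 < r\<close> by (intro cSup_least) (auto intro: less_imp_le)
      then show ?case
        using M0[of n] \<open>0 < r\<close> by simp
    qed
  qed
  define K where "K = {f :: nat \<Rightarrow>\<^sub>C 'k. \<forall>n. norm (apply_bcontfun f n) \<le> M n}"
  have "compact K"
    unfolding K_def using lim by (rule compact_c0_box)
  moreover have "K \<subseteq> c0"
    by (auto simp: K_def c0_def intro!: Lim_null_comparison[OF _ lim])
  ultimately have K: "compactin (top_of_set c0) K" "closedin (top_of_set c0) K"
    by (auto simp: compactin_subtopology compact_imp_closed closed_subset)
  have "A \<subseteq> K"
    using M by (auto simp: K_def)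
  then have "top_of_set c0 closure_of A \<subseteq> K"
    using K(2) by (rule closure_of_minimal)
  then show "precompact_in (top_of_set c0) A"
    unfolding precompact_in_def using K(1) closed_compactin closedin_closure_of by blast
qed

lemma weak_star_null_imp_operator_to_c0:
  fixes \<phi> :: "nat \<Rightarrow> 'a::banach \<Rightarrow>\<^sub>L 'k::real_normed_field"
  assumes "weak_star_null scl \<phi>"
  obtains T where "operator_to_c0 scl T" "\<And>x n. apply_bcontfun (T x) n = blinfun_apply (\<phi> n) x"
proof -
  obtain b where b: "\<And>n. norm (\<phi> n) \<le> b"
    using weak_star_null_imp_bounded[OF assms] by (auto simp: bounded_iff)
  have le: "norm (blinfun_apply (\<phi> n) x) \<le> norm x * b" for n x
    using norm_blinfun[of "\<phi> n" x] mult_right_mono[OF b[of n] norm_ge_zero[of x]]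
    by (simp add: mult.commute)
  define T where "T x = Bcontfun (\<lambda>n. blinfun_apply (\<phi> n) x)" for x
  have T: "apply_bcontfun (T x) n = blinfun_apply (\<phi> n) x" for x n
  proof -
    have "(\<lambda>n. blinfun_apply (\<phi> n) x) \<in> bcontfun"
      by (rule bcontfun_normI[of _ "norm x * b"]) (auto simp: le)
    then show ?thesis
      by (simp add: T_def Bcontfun_inverse)
  qed
  have "bounded_linear T"
  proof (rule bounded_linear_intro)
    show "norm (T x) \<le> norm x * b" for x
      by (rule norm_bound) (simp add: T le)
  qed (auto intro!: bcontfun_eqI simp: T blinfun.add_right blinfun.scaleR_right)
  moreover have "range T \<subseteq> c0"
  proof -
    have "apply_bcontfun (T x) = (\<lambda>n. blinfun_apply (\<phi> n) x)" for x
      by (rule ext) (rule T)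
    then show ?thesis
      using assms by (auto simp: c0_def weak_star_null_iff)
  qed
  moreover have "apply_bcontfun (T (scl c x)) n = c * apply_bcontfun (T x) n" for c x n
    using assms by (simp add: T weak_star_null_iff dual_def)
  ultimately show ?thesis
    using that[of T] T by (simp add: operator_to_c0_def)
qed

lemma operator_to_c0_imp_weak_star_null:
  assumes T: "operator_to_c0 scl T"
  obtains \<phi> where "weak_star_null scl \<phi>" "\<And>x n. blinfun_apply (\<phi> n) x = apply_bcontfun (T x) n"
proof -
  interpret T: bounded_linear T
    using T by (simp add: operator_to_c0_def)
  define \<phi> where "\<phi> n = Blinfun (\<lambda>x. apply_bcontfun (T x) n)" for n
  obtain b where b: "\<And>x. norm (T x) \<le> norm x * b"
    using T.bounded by blast
  have "bounded_linear (\<lambda>x. apply_bcontfun (T x) n)" for n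
    by (rule bounded_linear_intro[of _ b])
      (auto simp: T.add T.scaleR intro: order_trans[OF norm_bounded b])
  then have \<phi>: "blinfun_apply (\<phi> n) x = apply_bcontfun (T x) n" for n x
    by (simp add: \<phi>_def bounded_linear_Blinfun_apply)
  have "weak_star_null scl \<phi>"
    using T by (auto simp: weak_star_null_iff dual_def \<phi> operator_to_c0_def c0_def image_subset_iff)
  then show ?thesis
    using that \<phi> by blast
qed

text \<open>An operator into \<open>c0\<close> and the weak* null sequence of its coordinates determine
  each other.\<close>

lemma operator_to_c0_noncompact_iff:
  fixes scl :: "'k::real_or_complex \<Rightarrow> 'a::banach \<Rightarrow> 'a"
  assumes X: "bounded X"
  shows "(\<exists>T. operator_to_c0 scl T \<and> \<not> precompact_in (top_of_set c0) (T ` X)) \<longleftrightarrow>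
    (\<exists>\<phi>. weak_star_null scl \<phi> \<and> \<not> uniform_limit X (\<lambda>n. blinfun_apply (\<phi> n)) (\<lambda>_. 0) sequentially)"
proof -
  have corresponding: "precompact_in (top_of_set c0) (T ` X) \<longleftrightarrow>
      uniform_limit X (\<lambda>n. blinfun_apply (\<phi> n)) (\<lambda>_. 0) sequentially"
    if T: "operator_to_c0 scl T" and eq: "\<And>x n. apply_bcontfun (T x) n = blinfun_apply (\<phi> n) x" for T \<phi>
  proof -
    have "T ` X \<subseteq> c0" "bounded (T ` X)"
      using T bounded_linear_image[OF X] by (auto simp: operator_to_c0_def)
    then show ?thesis
      by (simp add: precompact_in_c0_iff uniform_limit_iff eq)
  qed
  show ?thesis
    using corresponding operator_to_c0_imp_weak_star_null weak_star_null_imp_operator_to_c0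
    by metis
qed

section \<open>Separated sequences and precompactness\<close>

text \<open>In a complete space precompact means totally bounded, and a separated sequence can be chosen
  greedily in a set without a finite net. The net is taken in \<open>B\<close> with closed balls, so
  that it also covers the closure.\<close>

lemma not_precompact_imp_separated_sequence:
  fixes B :: "'a::banach set"
  assumes "\<not> precompact_in euclidean B"
  obtains f :: "nat \<Rightarrow> 'a" and r where "0 < r" "range f \<subseteq> B" "\<And>m n. m < n \<Longrightarrow> r \<le> dist (f m) (f n)"
proof (rule ccontr)
  note separated = that
  assume no: "\<not> thesis"
  have "\<exists>K. finite K \<and> closure B \<subseteq> (\<Union>y\<in>K. ball y r)" if r: "0 < r" for r
  proof (rule ccontr)
    assume uncovered: "\<nexists>K. finite K \<and> closure B \<subseteq> (\<Union>y\<in>K. ball y r)"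
    have "\<exists>x\<in>B. \<forall>y\<in>F. r / 2 \<le> dist y x" if "finite F" "F \<subseteq> B" for F
    proof (rule ccontr)
      assume "\<not> ?thesis"
      then have "B \<subseteq> (\<Union>y\<in>F. cball y (r / 2))"
        by force
      then have "closure B \<subseteq> (\<Union>y\<in>F. cball y (r / 2))"
        using \<open>finite F\<close> by (intro closure_minimal) auto
      also have "\<dots> \<subseteq> (\<Union>y\<in>F. ball y r)"
        using r by (intro UN_mono) auto
      finally show False
        using uncovered \<open>finite F\<close> by blast
    qed
    then obtain f :: "nat \<Rightarrow> 'a" where "\<forall>n. f n \<in> B" "\<forall>m n. m < n \<longrightarrow> r / 2 \<le> dist (f m) (f n)"
      using greedy_sequence[of B "\<lambda>y x. r / 2 \<le> dist y x"] by metis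
    then show False
      using no separated[of "r / 2" f] r by (auto simp: image_subset_iff)
  qed
  then have "compact (closure B)"
    by (auto simp: compact_eq_totally_bounded complete_eq_closed)
  then show False
    using assms by (simp add: precompact_in_def)
qed

lemma separated_sequence_not_precompact:
  fixes f :: "nat \<Rightarrow> 'a::metric_space"
  assumes "0 < r" "\<And>m n. m < n \<Longrightarrow> r \<le> dist (f m) (f n)"
  shows "\<not> precompact_in euclidean (range f)"
proof
  assume "precompact_in euclidean (range f)"
  then have "compact (closure (range f))"
    by (simp add: precompact_in_def)
  then have "\<forall>e>0. \<exists>K. finite K \<and> closure (range f) \<subseteq> (\<Union>k\<in>K. ball k e)"
    by (simp add: compact_eq_totally_bounded)
  then obtain K where "finite K" and K: "closure (range f) \<subseteq> (\<Union>k\<in>K. ball k (r / 2))"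
    using assms(1) half_gt_zero by meson
  have "range f \<subseteq> (\<Union>k\<in>K. ball k (r / 2))"
    using closure_subset K by (rule subset_trans)
  then obtain Y where Y: "infinite Y" "\<forall>m\<in>Y. \<forall>n\<in>Y. dist (f m) (f n) < r"
    using infinite_subset_in_ball[OF infinite_UNIV_nat \<open>finite K\<close>, of f r] by auto
  obtain m where "m \<in> Y"
    using Y(1) by (metis finite.emptyI ex_in_conv)
  moreover obtain n where "n \<in> Y" "m < n"
    using Y(1) by (meson infinite_nat_iff_unbounded)
  ultimately show False
    using Y(2) assms(2) by (meson not_le)
qed

section \<open>Norming sets and selective sequential pseudocompactness\<close>

text \<open>Members of the sequence can be chosen in the given open sets. If some member is chosen
  infinitely often, there is a constant subsequence; otherwise the indices tend to infinity, and the
  chosen sequence itself tends to zero.\<close>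

lemma selectively_sequentially_pseudocompact_at_weak_star_null:
  fixes \<phi> :: "nat \<Rightarrow> 'a::real_normed_vector \<Rightarrow>\<^sub>L 'k::real_normed_field"
  assumes null: "weak_star_null scl \<phi>" and S: "S \<subseteq> range \<phi>"
  shows "selectively_sequentially_pseudocompact_at (weak_star scl) S"
  unfolding selectively_sequentially_pseudocompact_at_def
proof (intro conjI allI impI)
  show "S \<subseteq> topspace (weak_star scl)"
    using null S by (auto simp: topspace_weak_star weak_star_null_iff)
next
  fix U :: "nat \<Rightarrow> ('a \<Rightarrow>\<^sub>L 'k) set"
  assume "\<forall>n. openin (weak_star scl) (U n) \<and> U n \<inter> S \<noteq> {}"
  then have "\<forall>n. \<exists>i. \<phi> i \<in> U n"
    using S by blast
  then obtain i where i: "\<And>n. \<phi> (i n) \<in> U n"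
    by metis
  have "\<exists>r l. strict_mono r \<and> limitin (weak_star scl) ((\<phi> \<circ> i) \<circ> r) l sequentially"
  proof (cases "\<exists>k. infinite {n. i n = k}")
    case True
    then obtain k where k: "infinite {n. i n = k}" by blast
    let ?r = "enumerate {n. i n = k}"
    have "i (?r n) = k" for n
      using enumerate_in_set[OF k] by blast
    then have "limitin (weak_star scl) ((\<phi> \<circ> i) \<circ> ?r) (\<phi> k) sequentially"
      using null by (simp add: limitin_weak_star weak_star_null_iff)
    then show ?thesis
      using strict_mono_enumerate[OF k] by blast
  next
    case False
    have "\<forall>\<^sub>F n in sequentially. k \<le> i n" for k
    proof -
      have "{n. \<not> k \<le> i n} = (\<Union>j<k. {n. i n = j})" by auto
      then show ?thesis
        using False by (simp add: eventually_cofinite flip: cofinite_eq_sequentially)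
    qed
    then have "filterlim i sequentially sequentially"
      by (simp add: filterlim_at_top)
    then have "(\<lambda>n. blinfun_apply (\<phi> (i n)) x) \<longlonglongrightarrow> 0" for x
      using null by (intro filterlim_compose[of "\<lambda>n. blinfun_apply (\<phi> n) x" _ sequentially i])
        (auto simp: weak_star_null_iff)
    then have "limitin (weak_star scl) ((\<phi> \<circ> i) \<circ> id) 0 sequentially"
      using null by (simp add: limitin_weak_star weak_star_null_iff zero_in_dual)
    then show ?thesis
      using strict_mono_id by blast
  qed
  then show "\<exists>x. (\<forall>n. x n \<in> U n) \<and> (\<exists>r l. strict_mono r \<and> limitin (weak_star scl) (x \<circ> r) l sequentially)"
    using i by (intro exI[of _ "\<phi> \<circ> i"]) simp
qed

text \<open>The set \<open>N\<close> collects the indices at which \<open>\<phi>\<close> is large somewhere on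
  \<open>B\<close>, and \<open>b\<close> chooses such points. After thinning out, the value of a functional at its own
  point is at least twice as large as at the earlier points, so it detects the corresponding
  differences.\<close>

lemma weak_star_null_imp_norming:
  fixes \<phi> :: "nat \<Rightarrow> 'a::banach \<Rightarrow>\<^sub>L 'k::real_normed_field"
  assumes null: "weak_star_null scl \<phi>" and B: "bounded B"
    and nonunif: "\<not> uniform_limit B (\<lambda>n. blinfun_apply (\<phi> n)) (\<lambda>_. 0) sequentially"
  shows "\<exists>X\<subseteq>B. infinite X \<and> (\<exists>S\<subseteq>range \<phi>. norming scl (differences X) S)"
proof -
  obtain a where a: "0 < a" "\<not> (\<forall>\<^sub>F n in sequentially. \<forall>x\<in>B. norm (blinfun_apply (\<phi> n) x) < a)"
    using nonunif by (auto simp: uniform_limit_iff)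
  define N where "N = {n. \<exists>x\<in>B. a \<le> norm (blinfun_apply (\<phi> n) x)}"
  have "infinite N"
    using a(2) by (simp add: N_def eventually_cofinite not_less flip: cofinite_eq_sequentially)
  have "\<forall>n\<in>N. \<exists>x. x \<in> B \<and> a \<le> norm (blinfun_apply (\<phi> n) x)"
    by (auto simp: N_def)
  then obtain b where b: "\<And>n. n \<in> N \<Longrightarrow> b n \<in> B" "\<And>n. n \<in> N \<Longrightarrow> a \<le> norm (blinfun_apply (\<phi> n) (b n))"
    by metis
  obtain Y where Y: "Y \<subseteq> N" "infinite Y" and
    homogeneous: "(\<forall>n\<in>Y. \<forall>m\<in>Y. n < m \<longrightarrow> norm (blinfun_apply (\<phi> m) (b n)) < a / 2) \<or>
      (\<forall>n\<in>Y. \<forall>m\<in>Y. n < m \<longrightarrow> \<not> norm (blinfun_apply (\<phi> m) (b n)) < a / 2)"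
    by (rule Ramsey_pairs_nat[OF \<open>infinite N\<close>])
  \<comment> \<open>The other colour is impossible, as \<open>\<phi> m (b n)\<close> tends to zero with \<open>m\<close>.\<close>
  have small: "norm (blinfun_apply (\<phi> m) (b n)) < a / 2" if "n \<in> Y" "m \<in> Y" "n < m" for n m
  proof -
    have "\<forall>\<^sub>F m in sequentially. norm (blinfun_apply (\<phi> m) (b n)) < a / 2"
      using null a(1) tendstoD[of "\<lambda>m. blinfun_apply (\<phi> m) (b n)" 0 sequentially "a / 2"]
      by (simp add: weak_star_null_iff)
    then obtain M where M: "\<And>m. M \<le> m \<Longrightarrow> norm (blinfun_apply (\<phi> m) (b n)) < a / 2"
      by (auto simp: eventually_sequentially)
    obtain k where "k \<in> Y" "max M n < k"
      using Y(2) by (meson infinite_nat_iff_unbounded)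
    with M[of k] \<open>n \<in> Y\<close> homogeneous that show ?thesis
      by auto
  qed
  have jump: "a / 2 \<le> norm (blinfun_apply (\<phi> m) (b m - b n))" if "n \<in> Y" "m \<in> Y" "n < m" for n m
    using small[OF that] b(2)[of m] Y(1) that(2)
      norm_triangle_ineq2[of "blinfun_apply (\<phi> m) (b m)" "blinfun_apply (\<phi> m) (b n)"]
    by (auto simp: blinfun.diff_right subset_iff)
  have detect: "\<exists>k\<in>Y. a / 2 \<le> norm (blinfun_apply (\<phi> k) (b m - b n))" if "n \<in> Y" "m \<in> Y" "n \<noteq> m" for n m
    using jump[of n m] jump[of m n] that
    by (metis blinfun.diff_right norm_minus_commute linorder_neqE_nat)
  have "inj_on b Y"
  proof (rule inj_onI, rule ccontr)
    fix n m assume "n \<in> Y" "m \<in> Y" "b n = b m" "n \<noteq> m"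
    then show False
      using detect[of n m] a(1) by (simp add: blinfun.zero_right)
  qed
  then have "infinite (b ` Y)"
    using Y(2) finite_imageD by blast
  moreover have "b ` Y \<subseteq> B"
    using Y(1) b(1) by auto
  moreover have "norming scl (differences (b ` Y)) (\<phi> ` Y)"
    unfolding norming_def
  proof (intro conjI)
    show "\<phi> ` Y \<subseteq> dual scl"
      using null by (auto simp: weak_star_null_iff)
    show bdd: "bounded (\<phi> ` Y)"
      by (rule bounded_subset[OF weak_star_null_imp_bounded[OF null]]) auto
    then obtain c where c: "0 < c" "\<And>n. n \<in> Y \<Longrightarrow> norm (\<phi> n) \<le> c"
      by (auto simp: bounded_pos)
    obtain \<beta> where \<beta>: "0 < \<beta>" "\<And>x. x \<in> B \<Longrightarrow> norm x \<le> \<beta>"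
      using B by (auto simp: bounded_pos)
    \<comment> \<open>The first summand is for the upper estimate, the second for the lower one: differences have
        norm at most \<open>2 * \<beta>\<close>, and some functional is at least \<open>a / 2\<close> on each.\<close>
    define L where "L = c + 4 * \<beta> / a"
    have L: "0 < L" "c \<le> L" "2 * \<beta> \<le> L * (a / 2)"
      using a(1) c(1) \<beta>(1) by (auto simp: L_def field_simps add_pos_pos)
    have upper: "1 / L * sup_on_functionals (\<phi> ` Y) x \<le> norm x" for x
    proof -
      have "sup_on_functionals (\<phi> ` Y) x \<le> L * norm x"
      proof (rule sup_on_functionals_least)
        fix f assume "f \<in> \<phi> ` Y"
        then have "norm f \<le> L"
          using c(2) L(2) by force
        then show "norm (blinfun_apply f x) \<le> L * norm x"
          using norm_blinfun[of f x] by (meson mult_right_mono norm_ge_zero order_trans)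
      qed (use L in simp)
      then show ?thesis
        using L(1) by (simp add: field_simps)
    qed
    have lower: "norm x \<le> L * sup_on_functionals (\<phi> ` Y) x" if x: "x \<in> differences (b ` Y)" for x
    proof (cases "x = 0")
      case True
      then show ?thesis
        using sup_on_functionals_nonneg[OF bdd, of x] L(1) by simp
    next
      case False
      obtain n m where nm: "n \<in> Y" "m \<in> Y" "x = b m - b n"
        using x by (auto simp: differences_def)
      have "norm x \<le> norm (b m) + norm (b n)"
        unfolding nm(3) by (rule norm_triangle_ineq4)
      also have "\<dots> \<le> 2 * \<beta>"
        using \<beta>(2)[of "b m"] \<beta>(2)[of "b n"] b(1) Y(1) nm by fastforce
      also have "\<dots> \<le> L * (a / 2)"
        by (rule L(3))
      also have "a / 2 \<le> sup_on_functionals (\<phi> ` Y) x"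
        using detect[OF nm(1,2)] sup_on_functionals_upper[OF bdd] False nm(3)
        by (metis imageI order_trans right_minus_eq)
      finally show ?thesis
        using L(1) by simp
    qed
    show "\<exists>L>0. \<forall>x\<in>differences (b ` Y). 1 / L * sup_on_functionals (\<phi> ` Y) x \<le> norm x \<and>
        norm x \<le> L * sup_on_functionals (\<phi> ` Y) x"
      using L(1) upper lower by blast
  qed
  ultimately show ?thesis
    by (intro exI[of _ "b ` Y"]) blast
qed

text \<open>Each neighbourhood \<open>U n\<close> of \<open>s n\<close> controls a functional at
  \<open>x 0, ..., x n\<close> up to \<open>c / 4\<close>. For \<open>m < n\<close> the point \<open>x m\<close> is
  controlled by both \<open>U m\<close> and \<open>U n\<close>, so half of the jump \<open>c\<close> remains for any
  choice from these neighbourhoods.\<close>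

lemma norming_imp_weak_star_null:
  fixes scl :: "'k::real_or_complex \<Rightarrow> 'a::real_normed_vector \<Rightarrow> 'a"
  assumes S: "norming scl (differences X) S"
    and ssp: "selectively_sequentially_pseudocompact_at (weak_star scl) S"
    and X: "bounded X" "infinite X"
    and sep: "0 < r" "\<And>x y. x \<in> X \<Longrightarrow> y \<in> X \<Longrightarrow> x \<noteq> y \<Longrightarrow> r \<le> dist x y"
  shows "\<exists>\<phi>. weak_star_null scl \<phi> \<and>
    \<not> uniform_limit X (\<lambda>n. blinfun_apply (\<phi> n)) (\<lambda>_. 0) sequentially"
proof -
  obtain L where L: "0 < L" "\<And>x. x \<in> differences X \<Longrightarrow> norm x \<le> L * sup_on_functionals S x"
    using S by (auto simp: norming_def)
  have dualS: "S \<subseteq> dual scl" and bddS: "bounded S"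
    using S by (auto simp: norming_def)
  \<comment> \<open>Half of the separation \<open>r / L\<close> that the norming property gives for suprema, so that a
    single functional attains it.\<close>
  define d where "d = r / (2 * L)"
  have d: "0 < d" "L * d < r"
    using sep(1) L(1) by (auto simp: d_def)
  have apart: "\<exists>s\<in>S. d \<le> dist (blinfun_apply s x) (blinfun_apply s y)"
    if xy: "x \<in> X" "y \<in> X" "x \<noteq> y" for x y
  proof (rule ccontr)
    assume "\<not> ?thesis"
    then have "norm (blinfun_apply s (x - y)) \<le> d" if "s \<in> S" for s
      using that by (force simp: dist_norm blinfun.diff_right)
    then have "sup_on_functionals S (x - y) \<le> d"
      using d(1) by (intro sup_on_functionals_least) auto
    then have "L * sup_on_functionals S (x - y) \<le> L * d"
      using L(1) by simp
    moreover have "r \<le> L * sup_on_functionals S (x - y)"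
      using sep(2)[OF xy] L(2)[of "x - y"] xy by (force simp: differences_def dist_norm)
    ultimately show False
      using d(2) by simp
  qed
  have bddX: "bounded (blinfun_apply s ` X)" for s :: "'a \<Rightarrow>\<^sub>L 'k"
    by (rule bounded_linear_image[OF X(1) blinfun.bounded_linear_right])
  have bddSx: "bounded ((\<lambda>s. blinfun_apply s x) ` S)" for x
    by (rule bounded_linear_image[OF bddS blinfun.bounded_linear_left])
  obtain c s x where c: "0 < c" and s: "\<And>n :: nat. s n \<in> S" and x: "\<And>n. x n \<in> X"
    and jump: "\<And>m n. m < n \<Longrightarrow> c \<le> dist (blinfun_apply (s m) (x m)) (blinfun_apply (s n) (x m))"
    using separated_points_diagonal_jump[of X S blinfun_apply d, OF X(2) bddX bddSx d(1) apart]
    by auto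
  define U where "U n = {f \<in> dual scl. \<forall>y\<in>x ` {..n}. dist (blinfun_apply (s n) y) (blinfun_apply f y) < c / 4}"
    for n
  have "openin (weak_star scl) (U n)" "U n \<inter> S \<noteq> {}" for n
  proof -
    show "openin (weak_star scl) (U n)"
      unfolding U_def by (rule openin_weak_star_ball) simp
    have "s n \<in> U n"
      using s[of n] dualS c by (auto simp: U_def)
    then show "U n \<inter> S \<noteq> {}"
      using s[of n] by blast
  qed
  then obtain f \<rho> l where f: "\<And>n. f n \<in> U n" and \<rho>: "strict_mono \<rho>"
    and lim: "limitin (weak_star scl) (f \<circ> \<rho>) l sequentially"
    using ssp unfolding selectively_sequentially_pseudocompact_at_def by meson
  have far: "c / 2 < dist (blinfun_apply (f m) (x m)) (blinfun_apply (f n) (x m))" if "m < n" for m n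
  proof -
    have "dist (blinfun_apply (s m) (x m)) (blinfun_apply (f m) (x m)) < c / 4"
      "dist (blinfun_apply (s n) (x m)) (blinfun_apply (f n) (x m)) < c / 4"
      using f[of m] f[of n] that by (auto simp: U_def)
    moreover have "dist (blinfun_apply (s m) (x m)) (blinfun_apply (s n) (x m)) \<le>
        dist (blinfun_apply (s m) (x m)) (blinfun_apply (f m) (x m)) +
        dist (blinfun_apply (f m) (x m)) (blinfun_apply (f n) (x m)) +
        dist (blinfun_apply (s n) (x m)) (blinfun_apply (f n) (x m))"
      by metric
    ultimately show ?thesis
      using jump[OF that] by linarith
  qed
  define \<phi> where "\<phi> k = f (\<rho> k) - l" for k
  have "weak_star_null scl \<phi>"
  proof -
    have "l \<in> dual scl" and ptw: "(\<lambda>k. blinfun_apply (f (\<rho> k)) y) \<longlonglongrightarrow> blinfun_apply l y" for y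
      using lim by (auto simp: limitin_weak_star)
    moreover have "f n \<in> dual scl" for n
      using f[of n] by (simp add: U_def)
    moreover have "(\<lambda>k. blinfun_apply (f (\<rho> k)) y - blinfun_apply l y) \<longlonglongrightarrow> 0" for y
      using ptw[of y] by (simp add: LIM_zero)
    ultimately show ?thesis
      by (simp add: weak_star_null_iff \<phi>_def diff_in_dual blinfun.diff_left)
  qed
  moreover have "\<not> uniform_limit X (\<lambda>n. blinfun_apply (\<phi> n)) (\<lambda>_. 0) sequentially"
  proof
    assume "uniform_limit X (\<lambda>n. blinfun_apply (\<phi> n)) (\<lambda>_. 0) sequentially"
    then have "\<forall>\<^sub>F k in sequentially. \<forall>y\<in>X. dist (blinfun_apply (\<phi> k) y) 0 < c / 4"
      using c by (intro uniform_limitD) auto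
    then obtain K where K: "\<And>k y. K \<le> k \<Longrightarrow> y \<in> X \<Longrightarrow> norm (blinfun_apply (\<phi> k) y) < c / 4"
      by (auto simp: eventually_sequentially)
    let ?y = "x (\<rho> K)"
    have "norm (blinfun_apply (\<phi> K) ?y) < c / 4" "norm (blinfun_apply (\<phi> (Suc K)) ?y) < c / 4"
      using K[of K ?y] K[of "Suc K" ?y] x by auto
    moreover have "dist (blinfun_apply (f (\<rho> K)) ?y) (blinfun_apply (f (\<rho> (Suc K))) ?y)
        = norm (blinfun_apply (\<phi> K) ?y - blinfun_apply (\<phi> (Suc K)) ?y)"
      by (simp add: \<phi>_def blinfun.diff_left dist_norm)
    moreover have "c / 2 < dist (blinfun_apply (f (\<rho> K)) ?y) (blinfun_apply (f (\<rho> (Suc K))) ?y)"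
      using \<rho> by (intro far) (simp add: strict_mono_Suc_iff)
    ultimately show False
      using norm_triangle_ineq4[of "blinfun_apply (\<phi> K) ?y" "blinfun_apply (\<phi> (Suc K)) ?y"] by linarith
  qed
  ultimately show ?thesis by blast
qed

section \<open>The equivalence\<close>

theorem theorem2p1:
  fixes scl :: "'k::real_or_complex \<Rightarrow> 'a::banach \<Rightarrow> 'a"
  assumes "banach_space_over scl"
    and "infinite_dimensional scl"
  shows "(gelfand_phillips scl \<longleftrightarrow>
      (\<forall>X. bounded X \<and> \<not> precompact_in euclidean X \<longrightarrow>
        (\<exists>T. operator_to_c0 scl T \<and> \<not> precompact_in (top_of_set c0) (T ` X))))
    \<and> (gelfand_phillips scl \<longleftrightarrow>
      (\<forall>X. bounded X \<and> \<not> precompact_in euclidean X \<longrightarrow>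
        (\<exists>\<phi>. weak_star_null scl \<phi> \<and> \<not> (\<lambda>n. sup_on_points X (\<phi> n)) \<longlonglongrightarrow> 0)))
    \<and> (gelfand_phillips scl \<longleftrightarrow>
      (\<forall>B. bounded B \<and> \<not> precompact_in euclidean B \<longrightarrow>
        (\<exists>X\<subseteq>B. infinite X \<and>
          (\<exists>S. norming scl (differences X) S \<and>
               selectively_sequentially_pseudocompact_at (weak_star scl) S))))"
  (is "(?gp \<longleftrightarrow> ?operators) \<and> (?gp \<longleftrightarrow> ?functionals) \<and> (?gp \<longleftrightarrow> ?norming)")
proof -
  define detected where "detected X \<longleftrightarrow> (\<exists>\<phi>. weak_star_null scl \<phi> \<and>
    \<not> uniform_limit X (\<lambda>n. blinfun_apply (\<phi> n)) (\<lambda>_. 0) sequentially)" for X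
  have gp: "?gp \<longleftrightarrow> (\<forall>X. bounded X \<and> \<not> precompact_in euclidean X \<longrightarrow> detected X)"
    unfolding gelfand_phillips_def limited_def detected_def
    by (metis sup_on_points_tendsto_0_iff)
  have functionals: "?gp \<longleftrightarrow> ?functionals"
    unfolding gp detected_def by (metis sup_on_points_tendsto_0_iff)
  have operators: "?gp \<longleftrightarrow> ?operators"
    unfolding gp detected_def using operator_to_c0_noncompact_iff[of _ scl] by metis
  have "?norming" if ?gp
  proof (intro allI impI)
    fix B :: "'a set" assume B: "bounded B \<and> \<not> precompact_in euclidean B"
    with that gp obtain \<phi> where "weak_star_null scl \<phi>"
      "\<not> uniform_limit B (\<lambda>n. blinfun_apply (\<phi> n)) (\<lambda>_. 0) sequentially"
      unfolding detected_def by blast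
    with B show "\<exists>X\<subseteq>B. infinite X \<and> (\<exists>S. norming scl (differences X) S \<and>
        selectively_sequentially_pseudocompact_at (weak_star scl) S)"
      using weak_star_null_imp_norming selectively_sequentially_pseudocompact_at_weak_star_null by metis
  qed
  moreover have ?gp if ?norming
    unfolding gp
  proof (intro allI impI)
    fix B :: "'a set" assume B: "bounded B \<and> \<not> precompact_in euclidean B"
    obtain f :: "nat \<Rightarrow> 'a" and r where r: "0 < r" and f: "range f \<subseteq> B"
      and sep: "\<And>m n. m < n \<Longrightarrow> r \<le> dist (f m) (f n)"
      using not_precompact_imp_separated_sequence B by metis
    \<comment> \<open>Applied to \<open>B\<close> itself, the condition could yield a precompact set \<open>X\<close>; every infinite
      subset of the range of \<open>f\<close> is separated.\<close>
    have "bounded (range f)"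
      using B f bounded_subset by blast
    moreover have "\<not> precompact_in euclidean (range f)"
      using r sep by (rule separated_sequence_not_precompact)
    ultimately obtain X S where X: "X \<subseteq> range f" "infinite X"
      and S: "norming scl (differences X) S"
        "selectively_sequentially_pseudocompact_at (weak_star scl) S"
      using \<open>?norming\<close> by meson
    have sepX: "r \<le> dist x y" if xy: "x \<in> X" "y \<in> X" "x \<noteq> y" for x y
    proof -
      obtain m n where "x = f m" "y = f n"
        using xy X(1) by blast
      with \<open>x \<noteq> y\<close> sep[of m n] sep[of n m] show ?thesis
        by (metis dist_commute linorder_neqE_nat)
    qed
    have "bounded X" "X \<subseteq> B"
      using X(1) f B bounded_subset by blast+
    then show "detected B"
      using norming_imp_weak_star_null[OF S _ X(2) r sepX] uniform_limit_on_subset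
      unfolding detected_def by metis
  qed
  ultimately show ?thesis
    using functionals operators by blast
qed

end
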